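(* Let $\Gamma=(F,G,\eta,\rho)$ be a left wide Morita context between the abelian categories $\mathcal A$ and $\mathcal B$ (so $F:\mathcal B\to\mathcal A$, $G:\mathcal A\to\mathcal B$), such that the functors $F$ and $G$ have left adjoints $F':\mathcal A\to\mathcal B$ and $G':\mathcal B\to\mathcal A$. Then the categories $\mathcal A_{\Gamma,proj}$ and $\mathcal B_{\Gamma,proj}$ are equivalent via the functors $F'$ and $G'$ (restricted to these subcategories).
   Context: All functors are additive; subcategory means full subcategory. A left wide Morita context between abelian categories $\mathcal A$ and $\mathcal B$ is a datum $(F,G,\eta,\rho)$ where $F:\mathcal B\to\mathcal A$ and $G:\mathcal A\to\mathcal B$ are left exact functors and $\eta:1_{\mathcal A}\to F\circ G$, $\rho:1_{\mathcal B}\to G\circ F$ are natural transformations with $G\eta=\rho G$ and $F\rho=\eta F$. $\mathcal C_\Gamma=\{X\in\mathcal A\mid \eta(M)\circ f=0\text{ for every }M\in\mathcal A\text{ and every } f:X\to M\}$, and similarly $\mathcal D_\Gamma=\{Y\in\mathcal B\mid \rho(N)\circ f=0\text{ for every }N\in\mathcal B\text{ and every } f:Y\to N\}$. For a subcategory $\mathcal C$ of an abelian category $\mathcal A$, an object $M$ is $\mathcal C$-projective if for every epimorphism $p:X\to X'$ in $\mathcal A$ with $\operatorname{Ker}p\in\mathcal C$ and every morphism $f:M\to X'$ there is $g:M\to X$ with $p\circ g=f$. $M$ is $\mathcal C$-cotorsion free if for any $X\in\mathcal C$ every epimorphism $f:M\to X$ is zero. $\mathcal A_{\Gamma,proj}$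 is the full subcategory of $\mathcal A$ of all objects that are $\mathcal C_\Gamma$-cotorsion free and $\mathcal C_\Gamma$-projective; $\mathcal B_{\Gamma,proj}$ is the full subcategory of $\mathcal B$ of all objects that are $\mathcal D_\Gamma$-cotorsion free and $\mathcal D_\Gamma$-projective. *)

theory Defs
  imports "HOL-Algebra.Group"
begin

section \<open>Categories and preadditive categories\<close>

text \<open>
  A category is given by a set of objects and a single set of arrows with domain and codomain maps.
  The record also carries the addition and the zero arrows of the Hom-sets; these two fields are
  constrained only from \<open>preadditive_category\<close> on. All operations are total functions whose
  values outside the carrier sets are irrelevant. \<open>g \<cdot>\<^bsub>C\<^esub> f\<close> is \<open>f\<close> followed by \<open>g\<close>.
\<close>

record ('o, 'm) cat =
  Obj :: "'o set"
  Arr :: "'m set"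
  Dom :: "'m \<Rightarrow> 'o"
  Cod :: "'m \<Rightarrow> 'o"
  Id :: "'o \<Rightarrow> 'm"
  Comp :: "'m \<Rightarrow> 'm \<Rightarrow> 'm" (infixl "\<cdot>\<index>" 70)
  Plus :: "'m \<Rightarrow> 'm \<Rightarrow> 'm"
  Zero :: "'o \<Rightarrow> 'o \<Rightarrow> 'm"

definition Hom :: "('o, 'm) cat \<Rightarrow> 'o \<Rightarrow> 'o \<Rightarrow> 'm set" where
  "Hom C X Y = {f \<in> Arr C. Dom C f = X \<and> Cod C f = Y}"

locale category =
  fixes C :: "('o, 'm) cat" (structure)
  assumes Dom_in_Obj: "f \<in> Arr C \<Longrightarrow> Dom C f \<in> Obj C"
    and Cod_in_Obj: "f \<in> Arr C \<Longrightarrow> Cod C f \<in> Obj C"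
    and Id_in_Hom: "X \<in> Obj C \<Longrightarrow> Id C X \<in> Hom C X X"
    and Comp_in_Hom: "f \<in> Hom C X Y \<Longrightarrow> g \<in> Hom C Y Z \<Longrightarrow> g \<cdot> f \<in> Hom C X Z"
    and Comp_assoc: "f \<in> Hom C W X \<Longrightarrow> g \<in> Hom C X Y \<Longrightarrow> h \<in> Hom C Y Z
      \<Longrightarrow> (h \<cdot> g) \<cdot> f = h \<cdot> (g \<cdot> f)"
    and Comp_Id: "f \<in> Hom C X Y \<Longrightarrow> f \<cdot> Id C X = f"
    and Id_Comp: "f \<in> Hom C X Y \<Longrightarrow> Id C Y \<cdot> f = f"

definition Hom_group :: "('o, 'm) cat \<Rightarrow> 'o \<Rightarrow> 'o \<Rightarrow> 'm monoid" where
  "Hom_group C X Y = \<lparr>carrier = Hom C X Y, mult = Plus C, one = Zero C X Y\<rparr>"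

locale preadditive_category = category +
  assumes Hom_comm_group: "X \<in> Obj C \<Longrightarrow> Y \<in> Obj C \<Longrightarrow> comm_group (Hom_group C X Y)"
    and Comp_Plus_right: "f \<in> Hom C X Y \<Longrightarrow> f' \<in> Hom C X Y \<Longrightarrow> g \<in> Hom C Y Z
      \<Longrightarrow> g \<cdot> Plus C f f' = Plus C (g \<cdot> f) (g \<cdot> f')"
    and Comp_Plus_left: "f \<in> Hom C X Y \<Longrightarrow> g \<in> Hom C Y Z \<Longrightarrow> g' \<in> Hom C Y Z
      \<Longrightarrow> Plus C g g' \<cdot> f = Plus C (g \<cdot> f) (g' \<cdot> f)"


section \<open>Abelian categories\<close>

definition is_mono :: "('o, 'm) cat \<Rightarrow> 'm \<Rightarrow> bool" where
  "is_mono C m \<longleftrightarrow> m \<in> Arr C \<and>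
     (\<forall>W\<in>Obj C. \<forall>f\<in>Hom C W (Dom C m). \<forall>g\<in>Hom C W (Dom C m). m \<cdot>\<^bsub>C\<^esub> f = m \<cdot>\<^bsub>C\<^esub> g \<longrightarrow> f = g)"

definition is_epi :: "('o, 'm) cat \<Rightarrow> 'm \<Rightarrow> bool" where
  "is_epi C e \<longleftrightarrow> e \<in> Arr C \<and>
     (\<forall>W\<in>Obj C. \<forall>f\<in>Hom C (Cod C e) W. \<forall>g\<in>Hom C (Cod C e) W. f \<cdot>\<^bsub>C\<^esub> e = g \<cdot>\<^bsub>C\<^esub> e \<longrightarrow> f = g)"

definition is_iso :: "('o, 'm) cat \<Rightarrow> 'm \<Rightarrow> bool" where
  "is_iso C f \<longleftrightarrow> f \<in> Arr C \<and>
     (\<exists>g\<in>Hom C (Cod C f) (Dom C f). g \<cdot>\<^bsub>C\<^esub> f = Id C (Dom C f) \<and> f \<cdot>\<^bsub>C\<^esub> g = Id C (Cod C f))"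

definition is_kernel :: "('o, 'm) cat \<Rightarrow> 'm \<Rightarrow> 'm \<Rightarrow> bool" where
  "is_kernel C k f \<longleftrightarrow> f \<in> Arr C \<and> k \<in> Arr C \<and> Cod C k = Dom C f \<and>
     f \<cdot>\<^bsub>C\<^esub> k = Zero C (Dom C k) (Cod C f) \<and>
     (\<forall>W\<in>Obj C. \<forall>h\<in>Hom C W (Dom C f). f \<cdot>\<^bsub>C\<^esub> h = Zero C W (Cod C f) \<longrightarrow>
        (\<exists>!u. u \<in> Hom C W (Dom C k) \<and> k \<cdot>\<^bsub>C\<^esub> u = h))"

definition is_cokernel :: "('o, 'm) cat \<Rightarrow> 'm \<Rightarrow> 'm \<Rightarrow> bool" where
  "is_cokernel C c f \<longleftrightarrow> f \<in> Arr C \<and> c \<in> Arr C \<and> Dom C c = Cod C f \<and>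
     c \<cdot>\<^bsub>C\<^esub> f = Zero C (Dom C f) (Cod C c) \<and>
     (\<forall>W\<in>Obj C. \<forall>h\<in>Hom C (Cod C f) W. h \<cdot>\<^bsub>C\<^esub> f = Zero C (Dom C f) W \<longrightarrow>
        (\<exists>!u. u \<in> Hom C (Cod C c) W \<and> u \<cdot>\<^bsub>C\<^esub> c = h))"

definition is_zero_object :: "('o, 'm) cat \<Rightarrow> 'o \<Rightarrow> bool" where
  "is_zero_object C Z \<longleftrightarrow> Z \<in> Obj C \<and>
     (\<forall>X\<in>Obj C. (\<exists>!f. f \<in> Hom C X Z) \<and> (\<exists>!f. f \<in> Hom C Z X))"

definition is_biproduct ::
  "('o, 'm) cat \<Rightarrow> 'o \<Rightarrow> 'o \<Rightarrow> 'o \<Rightarrow> 'm \<Rightarrow> 'm \<Rightarrow> 'm \<Rightarrow> 'm \<Rightarrow> bool" where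
  "is_biproduct C X Y P i j p q \<longleftrightarrow> P \<in> Obj C \<and>
     i \<in> Hom C X P \<and> j \<in> Hom C Y P \<and> p \<in> Hom C P X \<and> q \<in> Hom C P Y \<and>
     p \<cdot>\<^bsub>C\<^esub> i = Id C X \<and> q \<cdot>\<^bsub>C\<^esub> j = Id C Y \<and>
     p \<cdot>\<^bsub>C\<^esub> j = Zero C Y X \<and> q \<cdot>\<^bsub>C\<^esub> i = Zero C X Y \<and>
     Plus C (i \<cdot>\<^bsub>C\<^esub> p) (j \<cdot>\<^bsub>C\<^esub> q) = Id C P"

locale abelian_category = preadditive_category +
  assumes ex_zero_object: "\<exists>Z. is_zero_object C Z"
    and ex_biproduct: "X \<in> Obj C \<Longrightarrow> Y \<in> Obj C \<Longrightarrow> \<exists>P i j p q. is_biproduct C X Y P i j p q"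
    and ex_kernel: "f \<in> Arr C \<Longrightarrow> \<exists>k. is_kernel C k f"
    and ex_cokernel: "f \<in> Arr C \<Longrightarrow> \<exists>c. is_cokernel C c f"
    and mono_is_kernel: "is_mono C m \<Longrightarrow> \<exists>f. is_kernel C m f"
    and epi_is_cokernel: "is_epi C e \<Longrightarrow> \<exists>f. is_cokernel C e f"


section \<open>Functors, natural transformations, adjunctions, equivalences\<close>

record ('o, 'm, 'p, 'n) func =
  ob :: "'o \<Rightarrow> 'p"
  ar :: "'m \<Rightarrow> 'n"

definition id_func :: "('o, 'm, 'o, 'm) func" where
  "id_func = \<lparr>ob = (\<lambda>X. X), ar = (\<lambda>f. f)\<rparr>"

definition comp_func ::
  "('p, 'n, 'q, 'r) func \<Rightarrow> ('o, 'm, 'p, 'n) func \<Rightarrow> ('o, 'm, 'q, 'r) func" where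
  "comp_func G F = \<lparr>ob = ob G \<circ> ob F, ar = ar G \<circ> ar F\<rparr>"

locale category_functor = C: category C + D: category D
  for C :: "('o, 'm) cat" and D :: "('p, 'n) cat" +
  fixes F :: "('o, 'm, 'p, 'n) func"
  assumes ob_in_Obj: "X \<in> Obj C \<Longrightarrow> ob F X \<in> Obj D"
    and ar_in_Hom: "f \<in> Hom C X Y \<Longrightarrow> ar F f \<in> Hom D (ob F X) (ob F Y)"
    and ar_Id: "X \<in> Obj C \<Longrightarrow> ar F (Id C X) = Id D (ob F X)"
    and ar_Comp: "f \<in> Hom C X Y \<Longrightarrow> g \<in> Hom C Y Z \<Longrightarrow> ar F (g \<cdot>\<^bsub>C\<^esub> f) = ar F g \<cdot>\<^bsub>D\<^esub> ar F f"

locale additive_functor = C: preadditive_category C + D: preadditive_category D +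
  category_functor C D F
  for C :: "('o, 'm) cat" and D :: "('p, 'n) cat" and F +
  assumes ar_hom: "X \<in> Obj C \<Longrightarrow> Y \<in> Obj C
    \<Longrightarrow> ar F \<in> hom (Hom_group C X Y) (Hom_group D (ob F X) (ob F Y))"

text \<open>
  \<open>0 \<rightarrow> X \<rightarrow> Y \<rightarrow> Z\<close> is exact iff \<open>X \<rightarrow> Y\<close> is a kernel of \<open>Y \<rightarrow> Z\<close>, so preserving such
  exact sequences is preserving kernels.
\<close>

locale left_exact_functor = C: abelian_category C + D: abelian_category D +
  additive_functor C D F
  for C :: "('o, 'm) cat" and D :: "('p, 'n) cat" and F +
  assumes preserves_kernel: "is_kernel C k f \<Longrightarrow> is_kernel D (ar F k) (ar F f)"

definition natural_transformation ::
  "('o, 'm) cat \<Rightarrow> ('p, 'n) cat \<Rightarrow> ('o, 'm, 'p, 'n) func \<Rightarrow> ('o, 'm, 'p, 'n) func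
    \<Rightarrow> ('o \<Rightarrow> 'n) \<Rightarrow> bool" where
  "natural_transformation C D F G \<tau> \<longleftrightarrow>
     (\<forall>X\<in>Obj C. \<tau> X \<in> Hom D (ob F X) (ob G X)) \<and>
     (\<forall>X\<in>Obj C. \<forall>Y\<in>Obj C. \<forall>f\<in>Hom C X Y. \<tau> Y \<cdot>\<^bsub>D\<^esub> ar F f = ar G f \<cdot>\<^bsub>D\<^esub> \<tau> X)"

definition natural_isomorphism ::
  "('o, 'm) cat \<Rightarrow> ('p, 'n) cat \<Rightarrow> ('o, 'm, 'p, 'n) func \<Rightarrow> ('o, 'm, 'p, 'n) func
    \<Rightarrow> ('o \<Rightarrow> 'n) \<Rightarrow> bool" where
  "natural_isomorphism C D F G \<tau> \<longleftrightarrow>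
     natural_transformation C D F G \<tau> \<and> (\<forall>X\<in>Obj C. is_iso D (\<tau> X))"

text \<open>
  \<open>L : C \<rightarrow> D\<close> is left adjoint to \<open>R : D \<rightarrow> C\<close>. The bijection \<open>\<phi>\<close> takes the
  objects as arguments, since an arrow \<open>L X \<rightarrow> Y\<close> does not determine \<open>X\<close>.
\<close>

definition is_left_adjoint ::
  "('o, 'm) cat \<Rightarrow> ('p, 'n) cat \<Rightarrow> ('o, 'm, 'p, 'n) func \<Rightarrow> ('p, 'n, 'o, 'm) func \<Rightarrow> bool" where
  "is_left_adjoint C D L R \<longleftrightarrow> category_functor C D L \<and> category_functor D C R \<and>
     (\<exists>\<phi>. (\<forall>X\<in>Obj C. \<forall>Y\<in>Obj D. bij_betw (\<phi> X Y) (Hom D (ob L X) Y) (Hom C X (ob R Y))) \<and>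
       (\<forall>X\<in>Obj C. \<forall>X'\<in>Obj C. \<forall>Y\<in>Obj D. \<forall>Y'\<in>Obj D.
         \<forall>u\<in>Hom C X' X. \<forall>v\<in>Hom D Y Y'. \<forall>f\<in>Hom D (ob L X) Y.
           \<phi> X' Y' (v \<cdot>\<^bsub>D\<^esub> f \<cdot>\<^bsub>D\<^esub> ar L u) = ar R v \<cdot>\<^bsub>C\<^esub> \<phi> X Y f \<cdot>\<^bsub>C\<^esub> u))"

definition full_subcategory :: "('o, 'm) cat \<Rightarrow> 'o set \<Rightarrow> ('o, 'm) cat" where
  "full_subcategory C S = C\<lparr>Obj := Obj C \<inter> S, Arr := {f \<in> Arr C. Dom C f \<in> S \<and> Cod C f \<in> S}\<rparr>"

text \<open>
  Applied to full subcategories, the first two conjuncts say that the functors restrict to them.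
\<close>

definition equivalent_via ::
  "('o, 'm) cat \<Rightarrow> ('p, 'n) cat \<Rightarrow> ('o, 'm, 'p, 'n) func \<Rightarrow> ('p, 'n, 'o, 'm) func \<Rightarrow> bool" where
  "equivalent_via C D F G \<longleftrightarrow> additive_functor C D F \<and> additive_functor D C G \<and>
     (\<exists>\<sigma>. natural_isomorphism C C (comp_func G F) id_func \<sigma>) \<and>
     (\<exists>\<tau>. natural_isomorphism D D (comp_func F G) id_func \<tau>)"


section \<open>Relative projectivity and wide Morita contexts\<close>

text \<open>
  In the next two definitions \<open>S\<close> is the object set of a full subcategory of \<open>C\<close>. Kernels being
  determined up to isomorphism only, \<open>Ker p \<in> S\<close> is read as: some kernel of \<open>p\<close> has its domain
  in \<open>S\<close>.
\<close>

definition is_projective_rel :: "('o, 'm) cat \<Rightarrow> 'o set \<Rightarrow> 'o \<Rightarrow> bool" where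
  "is_projective_rel C S M \<longleftrightarrow> M \<in> Obj C \<and>
     (\<forall>X\<in>Obj C. \<forall>X'\<in>Obj C. \<forall>p\<in>Hom C X X'.
       is_epi C p \<and> (\<exists>k. is_kernel C k p \<and> Dom C k \<in> S) \<longrightarrow>
       (\<forall>f\<in>Hom C M X'. \<exists>g\<in>Hom C M X. p \<cdot>\<^bsub>C\<^esub> g = f))"

definition is_cotorsion_free :: "('o, 'm) cat \<Rightarrow> 'o set \<Rightarrow> 'o \<Rightarrow> bool" where
  "is_cotorsion_free C S M \<longleftrightarrow> M \<in> Obj C \<and>
     (\<forall>X\<in>S. \<forall>f\<in>Hom C M X. is_epi C f \<longrightarrow> f = Zero C M X)"

locale left_wide_Morita_context =
  F: left_exact_functor B A F + G: left_exact_functor A B G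
  for A :: "('a, 'm) cat" and B :: "('b, 'n) cat"
    and F :: "('b, 'n, 'a, 'm) func" and G :: "('a, 'm, 'b, 'n) func" +
  fixes \<eta> :: "'a \<Rightarrow> 'm" and \<rho> :: "'b \<Rightarrow> 'n"
  assumes natural_eta: "natural_transformation A A id_func (comp_func F G) \<eta>"
    and natural_rho: "natural_transformation B B id_func (comp_func G F) \<rho>"
    and G_eta: "X \<in> Obj A \<Longrightarrow> ar G (\<eta> X) = \<rho> (ob G X)"
    and F_rho: "Y \<in> Obj B \<Longrightarrow> ar F (\<rho> Y) = \<eta> (ob F Y)"

text \<open>
  For \<open>\<Gamma> = (F, G, \<eta>, \<rho>)\<close>, the classes \<open>\<C>\<^sub>\<Gamma>\<close> and \<open>\<D>\<^sub>\<Gamma>\<close> are \<open>annihilated A \<eta>\<close> and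
  \<open>annihilated B \<rho>\<close>; the object sets of \<open>\<A>\<^sub>\<Gamma>\<^sub>,\<^sub>p\<^sub>r\<^sub>o\<^sub>j\<close> and \<open>\<B>\<^sub>\<Gamma>\<^sub>,\<^sub>p\<^sub>r\<^sub>o\<^sub>j\<close> are
  \<open>proj_objects A \<eta>\<close> and \<open>proj_objects B \<rho>\<close>.
\<close>

definition annihilated :: "('o, 'm) cat \<Rightarrow> ('o \<Rightarrow> 'm) \<Rightarrow> 'o set" where
  "annihilated C \<tau> = {X \<in> Obj C. \<forall>M\<in>Obj C. \<forall>f\<in>Hom C X M. \<tau> M \<cdot>\<^bsub>C\<^esub> f = Zero C X (Cod C (\<tau> M))}"

definition proj_objects :: "('o, 'm) cat \<Rightarrow> ('o \<Rightarrow> 'm) \<Rightarrow> 'o set" where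
  "proj_objects C \<tau> = {M \<in> Obj C. is_cotorsion_free C (annihilated C \<tau>) M \<and>
     is_projective_rel C (annihilated C \<tau>) M}"

end

theory Submission
  imports Defs
begin

text \<open>
  Transposing along the adjunctions turns \<open>(F, G, \<eta>, \<rho>)\<close> into a right wide Morita context
  \<open>(F', G', \<epsilon>, \<delta>)\<close>: right exact functors with \<open>\<epsilon> : G' F' \<rightarrow> 1\<close>, \<open>\<delta> : F' G' \<rightarrow> 1\<close>,
  \<open>F' \<epsilon> = \<delta> F'\<close> and \<open>G' \<delta> = \<epsilon> G'\<close>; an object lies in \<open>\<C>\<^sub>\<Gamma>\<close> iff \<open>\<epsilon>\<close> vanishes at it. The kernel
  and the cokernel of \<open>\<epsilon> X\<close> lie in \<open>\<C>\<^sub>\<Gamma>\<close>. Hence for \<open>X\<close> in \<open>\<A>\<^sub>\<Gamma>\<^sub>,\<^sub>p\<^sub>r\<^sub>o\<^sub>j\<close> the map \<open>\<epsilon> X\<close> is a split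
  epimorphism, and the complementary projection of \<open>G' F' X\<close> onto \<open>Ker (\<epsilon> X)\<close> vanishes because it
  kills the epimorphism \<open>\<epsilon> (G' F' X) = G' F' (\<epsilon> X)\<close>. So \<open>\<epsilon> X\<close> is invertible.
\<close>

section \<open>Preadditive and abelian categories\<close>

lemma (in category) Hom_Obj:
  assumes "f \<in> Hom C X Y"
  shows "X \<in> Obj C" "Y \<in> Obj C"
  using assms Dom_in_Obj Cod_in_Obj by (auto simp: Hom_def)

lemma (in category) mono_cancel:
  assumes "is_mono C m" "m \<in> Hom C X Y" "f \<in> Hom C W X" "g \<in> Hom C W X" "m \<cdot> f = m \<cdot> g"
  shows "f = g"
  using assms Hom_Obj[OF assms(3)] unfolding is_mono_def Hom_def by auto

lemma (in category) epi_cancel: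
  assumes "is_epi C e" "e \<in> Hom C X Y" "f \<in> Hom C Y W" "g \<in> Hom C Y W" "f \<cdot> e = g \<cdot> e"
  shows "f = g"
  using assms Hom_Obj[OF assms(3)] unfolding is_epi_def Hom_def by auto

section \<open>Arithmetic of arrows and tests for epimorphisms\<close>

context preadditive_category
begin

lemma Zero_in_Hom:
  assumes "X \<in> Obj C" "Y \<in> Obj C"
  shows "Zero C X Y \<in> Hom C X Y"
proof -
  interpret H: comm_group "Hom_group C X Y" using assms by (rule Hom_comm_group)
  show ?thesis using H.one_closed by (simp add: Hom_group_def)
qed

lemma Plus_Zero:
  assumes "f \<in> Hom C X Y"
  shows "Plus C f (Zero C X Y) = f" "Plus C (Zero C X Y) f = f"
proof -
  interpret H: comm_group "Hom_group C X Y" using Hom_Obj[OF assms(1)] by (rule Hom_comm_group)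
  show "Plus C f (Zero C X Y) = f" "Plus C (Zero C X Y) f = f"
    using H.r_one H.l_one assms by (simp_all add: Hom_group_def)
qed

lemma Plus_eq_self:
  assumes "f \<in> Hom C X Y" "g \<in> Hom C X Y" "Plus C f g = g"
  shows "f = Zero C X Y"
proof -
  interpret H: comm_group "Hom_group C X Y" using Hom_Obj[OF assms(1)] by (rule Hom_comm_group)
  show ?thesis using H.r_cancel_one[of g f] assms by (simp add: Hom_group_def)
qed

text \<open>Supplies subtraction: \<open>d\<close> is \<open>f\<close> minus \<open>g\<close>,
  formed with the inverse of the Hom-group since the record has no negation. It reduces an equality
  of arrows to the vanishing of one arrow.\<close>

lemma ex_diff:
  assumes "f \<in> Hom C X Y" "g \<in> Hom C X Y"
  obtains d where "d \<in> Hom C X Y" "Plus C d g = f"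
proof -
  interpret H: comm_group "Hom_group C X Y" using Hom_Obj[OF assms(1)] by (rule Hom_comm_group)
  let ?d = "f \<otimes>\<^bsub>Hom_group C X Y\<^esub> inv\<^bsub>Hom_group C X Y\<^esub> g"
  have c: "f \<in> carrier (Hom_group C X Y)" "g \<in> carrier (Hom_group C X Y)"
    using assms by (auto simp: Hom_group_def)
  have "?d \<in> carrier (Hom_group C X Y)" "?d \<otimes>\<^bsub>Hom_group C X Y\<^esub> g = f"
    using c by (simp_all add: H.m_assoc)
  then show thesis using that[of ?d] by (simp add: Hom_group_def)
qed

text \<open>By distributivity the composite added to itself is itself, so cancellation in the
  Hom-group makes it zero.\<close>

lemma Comp_Zero:
  assumes "X \<in> Obj C" "g \<in> Hom C Y Z"
  shows "g \<cdot> Zero C X Y = Zero C X Z"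
proof -
  have z: "Zero C X Y \<in> Hom C X Y" using assms Hom_Obj Zero_in_Hom by blast
  have "g \<cdot> Zero C X Y \<in> Hom C X Z" using Comp_in_Hom z assms by blast
  moreover have "Plus C (g \<cdot> Zero C X Y) (g \<cdot> Zero C X Y) = g \<cdot> Zero C X Y"
    using Comp_Plus_right[OF z z assms(2)] Plus_Zero[OF z] by simp
  ultimately show ?thesis using Plus_eq_self by blast
qed

lemma Zero_Comp:
  assumes "Z \<in> Obj C" "f \<in> Hom C X Y"
  shows "Zero C Y Z \<cdot> f = Zero C X Z"
proof -
  have z: "Zero C Y Z \<in> Hom C Y Z" using assms Hom_Obj Zero_in_Hom by blast
  have "Zero C Y Z \<cdot> f \<in> Hom C X Z" using Comp_in_Hom z assms by blast
  moreover have "Plus C (Zero C Y Z \<cdot> f) (Zero C Y Z \<cdot> f) = Zero C Y Z \<cdot> f"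
    using Comp_Plus_left[OF assms(2) z z] Plus_Zero[OF z] by simp
  ultimately show ?thesis using Plus_eq_self by blast
qed

text \<open>If two arrows agree after precomposition with \<open>e\<close>, their difference is
  killed by \<open>e\<close>, so it suffices to test such arrows.\<close>

lemma is_epiI:
  assumes e: "e \<in> Hom C X Y"
    and kill: "\<And>W g. g \<in> Hom C Y W \<Longrightarrow> g \<cdot> e = Zero C X W \<Longrightarrow> g = Zero C Y W"
  shows "is_epi C e"
proof -
  have "f = g" if f: "f \<in> Hom C Y W" and g: "g \<in> Hom C Y W" and eq: "f \<cdot> e = g \<cdot> e" for W f g
  proof -
    obtain d where d: "d \<in> Hom C Y W" "Plus C d g = f" using ex_diff[OF f g] .
    have "Plus C (d \<cdot> e) (g \<cdot> e) = g \<cdot> e" using Comp_Plus_left[OF e d(1) g] d(2) eq by simp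
    then have "d \<cdot> e = Zero C X W" using Plus_eq_self Comp_in_Hom e d(1) g by blast
    then have "d = Zero C Y W" using kill d(1) by blast
    then show ?thesis using Plus_Zero(2)[OF g] d(2) by simp
  qed
  then show ?thesis using e unfolding is_epi_def Hom_def by auto
qed

lemma epi_kill:
  assumes "is_epi C e" "e \<in> Hom C X Y" "g \<in> Hom C Y W" "g \<cdot> e = Zero C X W"
  shows "g = Zero C Y W"
proof -
  have "Zero C Y W \<cdot> e = Zero C X W" using Zero_Comp Hom_Obj assms by blast
  then show ?thesis using epi_cancel assms Zero_in_Hom Hom_Obj by metis
qed

section \<open>Kernels and cokernels through their universal properties\<close>

lemma is_kernel_Hom:
  assumes "is_kernel C k f" "f \<in> Hom C X Y"
  shows "k \<in> Hom C (Dom C k) X" "f \<cdot> k = Zero C (Dom C k) Y"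
  using assms by (auto simp: is_kernel_def Hom_def)

lemma is_kernel_factor:
  assumes "is_kernel C k f" "f \<in> Hom C X Y" "h \<in> Hom C W X" "f \<cdot> h = Zero C W Y"
  obtains u where "u \<in> Hom C W (Dom C k)" "k \<cdot> u = h"
proof -
  have "Dom C f = X" "Cod C f = Y" using assms(2) by (simp_all add: Hom_def)
  then have "\<exists>!u. u \<in> Hom C W (Dom C k) \<and> k \<cdot> u = h"
    using assms Hom_Obj[OF assms(3)] unfolding is_kernel_def by blast
  then show thesis using that by blast
qed

text \<open>If \<open>k \<cdot> u = k \<cdot> v\<close>, then \<open>u\<close> and \<open>v\<close>
  are two factorisations through \<open>k\<close> of one arrow killed by \<open>f\<close>, and such
  factorisations are unique.\<close>

lemma is_kernel_mono:
  assumes "is_kernel C k f"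
  shows "is_mono C k"
proof -
  let ?K = "Dom C k" and ?X = "Dom C f" and ?Y = "Cod C f"
  have f: "f \<in> Hom C ?X ?Y" using assms by (auto simp: is_kernel_def Hom_def)
  note k = is_kernel_Hom[OF assms f]
  have "u = v" if u: "u \<in> Hom C W ?K" and v: "v \<in> Hom C W ?K" and eq: "k \<cdot> u = k \<cdot> v" for W u v
  proof -
    have W: "W \<in> Obj C" using Hom_Obj u by blast
    have "f \<cdot> (k \<cdot> u) = Zero C W ?Y"
      using Comp_assoc[OF u k(1) f] k(2) Zero_Comp[OF _ u] Hom_Obj[OF f] by simp
    moreover have "k \<cdot> u \<in> Hom C W ?X" using Comp_in_Hom u k(1) by blast
    ultimately have "\<exists>!w. w \<in> Hom C W ?K \<and> k \<cdot> w = k \<cdot> u"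
      using assms W unfolding is_kernel_def by auto
    then show ?thesis using u v eq by metis
  qed
  then show ?thesis using k(1) unfolding is_mono_def Hom_def by auto
qed

lemma is_cokernel_Hom:
  assumes "is_cokernel C c f" "f \<in> Hom C X Y"
  shows "c \<in> Hom C Y (Cod C c)" "c \<cdot> f = Zero C X (Cod C c)"
  using assms by (auto simp: is_cokernel_def Hom_def)

lemma is_cokernel_factor:
  assumes "is_cokernel C c f" "f \<in> Hom C X Y" "h \<in> Hom C Y W" "h \<cdot> f = Zero C X W"
  obtains u where "u \<in> Hom C (Cod C c) W" "u \<cdot> c = h"
proof -
  have "Dom C f = X" "Cod C f = Y" using assms(2) by (simp_all add: Hom_def)
  then have "\<exists>!u. u \<in> Hom C (Cod C c) W \<and> u \<cdot> c = h"
    using assms Hom_Obj[OF assms(3)] unfolding is_cokernel_def by blast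
  then show thesis using that by blast
qed

text \<open>If \<open>g \<cdot> c = 0\<close>, then \<open>g\<close> and the zero arrow both factor
  the zero arrow through \<open>c\<close>, so uniqueness gives \<open>g = 0\<close>.\<close>

lemma is_cokernel_epi:
  assumes "is_cokernel C c f"
  shows "is_epi C c"
proof -
  let ?X = "Dom C f" and ?Y = "Cod C f" and ?Q = "Cod C c"
  have f: "f \<in> Hom C ?X ?Y" using assms by (auto simp: is_cokernel_def Hom_def)
  note c = is_cokernel_Hom[OF assms f]
  have "g = Zero C ?Q W" if g: "g \<in> Hom C ?Q W" and eq: "g \<cdot> c = Zero C ?Y W" for W g
  proof -
    have W: "W \<in> Obj C" using Hom_Obj g by blast
    have "Zero C ?Y W \<cdot> f = Zero C ?X W" using Zero_Comp[OF W f] .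
    moreover have "Zero C ?Y W \<in> Hom C ?Y W" using Zero_in_Hom Hom_Obj f W by blast
    ultimately have "\<exists>!w. w \<in> Hom C ?Q W \<and> w \<cdot> c = Zero C ?Y W"
      using assms W unfolding is_cokernel_def by auto
    moreover have "Zero C ?Q W \<in> Hom C ?Q W" "Zero C ?Q W \<cdot> c = Zero C ?Y W"
      using Zero_in_Hom Zero_Comp Hom_Obj c(1) W by blast+
    ultimately show ?thesis using g eq by blast
  qed
  then show ?thesis using is_epiI[OF c(1)] by blast
qed

end

section \<open>Epimorphisms and images in an abelian category\<close>

context abelian_category
begin

text \<open>The axioms make \<open>p\<close> a cokernel of some \<open>g\<close>. Since
  \<open>p \<cdot> g = 0\<close>, \<open>g\<close> factors through \<open>l\<close>; an arrow
  killing \<open>l\<close> therefore kills \<open>g\<close> and factors through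
  \<open>p\<close>.\<close>

lemma epi_is_cokernel_of_kernel:
  assumes p: "is_epi C p" "p \<in> Hom C X Y" and l: "is_kernel C l p"
  shows "is_cokernel C p l"
proof -
  note l' = is_kernel_Hom[OF l p(2)]
  obtain g where g: "is_cokernel C p g" using epi_is_cokernel p(1) by blast
  have gh: "g \<in> Hom C (Dom C g) X" using g p(2) by (auto simp: is_cokernel_def Hom_def)
  have cod: "Cod C p = Y" using p(2) by (simp add: Hom_def)
  note pg = is_cokernel_Hom[OF g gh, unfolded cod]
  obtain w where w: "w \<in> Hom C (Dom C g) (Dom C l)" "l \<cdot> w = g"
    using is_kernel_factor[OF l p(2) gh pg(2)] .
  have "\<exists>!u. u \<in> Hom C Y W \<and> u \<cdot> p = h"
    if h: "h \<in> Hom C X W" "h \<cdot> l = Zero C (Dom C l) W" for W h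
  proof -
    have "h \<cdot> g = Zero C (Dom C g) W"
      using Comp_assoc[OF w(1) l'(1) h(1)] h w Zero_Comp[OF _ w(1)] Hom_Obj[OF h(1)] by simp
    then obtain u where u: "u \<in> Hom C Y W" "u \<cdot> p = h"
      using is_cokernel_factor[OF g gh h(1)] unfolding cod by blast
    then show ?thesis using epi_cancel[OF p] by blast
  qed
  moreover have "l \<in> Arr C" "Cod C l = X" "p \<in> Arr C" "Dom C p = X"
    using l'(1) p(2) by (auto simp: Hom_def)
  ultimately show "is_cokernel C p l" using l'(2) cod unfolding is_cokernel_def by auto
qed

text \<open>
  If \<open>g \<cdot> e = 0\<close> and \<open>n\<close> is a kernel of \<open>g\<close>, then \<open>k \<cdot> n\<close> is a kernel of some \<open>h\<close>. As \<open>h\<close> kills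
  \<open>f\<close>, it kills \<open>k\<close>, so \<open>k\<close> factors through \<open>k \<cdot> n\<close> and \<open>n\<close> is a split epimorphism.
\<close>

lemma epi_onto_image:
  assumes f: "f \<in> Hom C X Y" and c: "is_cokernel C c f" and k: "is_kernel C k c"
    and e: "e \<in> Hom C X (Dom C k)" and ke: "k \<cdot> e = f"
  shows "is_epi C e"
proof (rule is_epiI[OF e])
  fix W g
  let ?K = "Dom C k"
  assume g: "g \<in> Hom C ?K W" and ge: "g \<cdot> e = Zero C X W"
  note ch = is_cokernel_Hom[OF c f]
  note kh = is_kernel_Hom[OF k ch(1)]
  obtain n where n: "is_kernel C n g" using ex_kernel g by (auto simp: Hom_def)
  let ?N = "Dom C n"
  note nh = is_kernel_Hom[OF n g]
  obtain e' where e': "e' \<in> Hom C X ?N" "n \<cdot> e' = e" using is_kernel_factor[OF n g e ge] .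
  have kn: "k \<cdot> n \<in> Hom C ?N Y" using Comp_in_Hom nh(1) kh(1) by blast
  have "is_mono C (k \<cdot> n)"
  proof -
    have "u = v" if u: "u \<in> Hom C V ?N" and v: "v \<in> Hom C V ?N" and eq: "(k \<cdot> n) \<cdot> u = (k \<cdot> n) \<cdot> v"
      for V u v
    proof -
      have "k \<cdot> (n \<cdot> u) = k \<cdot> (n \<cdot> v)"
        using eq Comp_assoc[OF u nh(1) kh(1)] Comp_assoc[OF v nh(1) kh(1)] by simp
      then have "n \<cdot> u = n \<cdot> v"
        using mono_cancel[OF is_kernel_mono[OF k] kh(1)] Comp_in_Hom[OF _ nh(1)] u v by blast
      then show ?thesis using mono_cancel[OF is_kernel_mono[OF n] nh(1)] u v by blast
    qed
    then show ?thesis using kn unfolding is_mono_def Hom_def by auto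
  qed
  then obtain h where h: "is_kernel C (k \<cdot> n) h" using mono_is_kernel by blast
  have hh: "h \<in> Hom C Y (Cod C h)" using h kn by (auto simp: is_kernel_def Hom_def)
  have dom: "Dom C (k \<cdot> n) = ?N" using kn by (simp add: Hom_def)
  note hkn = is_kernel_Hom[OF h hh, unfolded dom]
  have f_eq: "f = (k \<cdot> n) \<cdot> e'" using Comp_assoc[OF e'(1) nh(1) kh(1)] e'(2) ke by simp
  have "h \<cdot> f = Zero C X (Cod C h)"
    unfolding f_eq using Comp_assoc[OF e'(1) kn hh] hkn(2) Zero_Comp[OF _ e'(1)] Hom_Obj[OF hh] by simp
  then obtain u where u: "u \<in> Hom C (Cod C c) (Cod C h)" "u \<cdot> c = h"
    using is_cokernel_factor[OF c f hh] by blast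
  have "h \<cdot> k = Zero C ?K (Cod C h)"
    using Comp_assoc[OF kh(1) ch(1) u(1)] u(2) kh(2) Comp_Zero[OF _ u(1)] Hom_Obj[OF g] by simp
  then obtain t where t: "t \<in> Hom C ?K ?N" "(k \<cdot> n) \<cdot> t = k"
    using is_kernel_factor[OF h hh kh(1)] unfolding dom by blast
  have I: "Id C ?K \<in> Hom C ?K ?K" using Id_in_Hom Hom_Obj g by blast
  have "k \<cdot> (n \<cdot> t) = k \<cdot> Id C ?K"
    using t(2) Comp_assoc[OF t(1) nh(1) kh(1)] Comp_Id[OF kh(1)] by simp
  then have nt: "n \<cdot> t = Id C ?K"
    using mono_cancel[OF is_kernel_mono[OF k] kh(1)] Comp_in_Hom[OF t(1) nh(1)] I by blast
  have "g = (g \<cdot> n) \<cdot> t" using Comp_assoc[OF t(1) nh(1) g] nt Comp_Id[OF g] by simp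
  also have "\<dots> = Zero C ?K W" using nh(2) Zero_Comp[OF _ t(1)] Hom_Obj[OF g] by simp
  finally show "g = Zero C ?K W" .
qed

end

section \<open>Functors and adjunctions\<close>

lemma (in additive_functor) ar_Zero:
  assumes "X \<in> Obj C" "Y \<in> Obj C"
  shows "ar F (Zero C X Y) = Zero D (ob F X) (ob F Y)"
proof -
  interpret H: comm_group "Hom_group C X Y" using assms by (rule C.Hom_comm_group)
  interpret K: comm_group "Hom_group D (ob F X) (ob F Y)"
    using assms ob_in_Obj by (intro D.Hom_comm_group)
  show ?thesis using hom_one[OF ar_hom[OF assms] H.is_group K.is_group] by (simp add: Hom_group_def)
qed

text \<open>Encoded dually to \<open>left_exact_functor\<close>:
  \<open>X \<rightarrow> Y \<rightarrow> Z \<rightarrow> 0\<close> is exact iff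
  \<open>Y \<rightarrow> Z\<close> is a cokernel of \<open>X \<rightarrow> Y\<close>.\<close>

locale right_exact_functor = C: abelian_category C + D: abelian_category D +
  additive_functor C D F
  for C :: "('o, 'm) cat" and D :: "('p, 'n) cat" and F +
  assumes preserves_cokernel: "is_cokernel C c f \<Longrightarrow> is_cokernel D (ar F c) (ar F f)"
begin

lemma preserves_epi: "is_epi C e \<Longrightarrow> is_epi D (ar F e)"
  using C.epi_is_cokernel preserves_cokernel D.is_cokernel_epi by blast

end

text \<open>Makes the bijection hidden in \<open>is_left_adjoint\<close> a parameter, so that
  transposes can be named.\<close>

locale adjunction = L: category_functor C D L + R: category_functor D C R
  for C :: "('o, 'm) cat" and D :: "('p, 'n) cat" and L R +
  fixes \<phi> :: "'o \<Rightarrow> 'p \<Rightarrow> 'n \<Rightarrow> 'm"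
  assumes bij: "X \<in> Obj C \<Longrightarrow> Y \<in> Obj D
      \<Longrightarrow> bij_betw (\<phi> X Y) (Hom D (ob L X) Y) (Hom C X (ob R Y))"
    and natural: "u \<in> Hom C X' X \<Longrightarrow> v \<in> Hom D Y Y' \<Longrightarrow> f \<in> Hom D (ob L X) Y
      \<Longrightarrow> \<phi> X' Y' (v \<cdot>\<^bsub>D\<^esub> f \<cdot>\<^bsub>D\<^esub> ar L u) = ar R v \<cdot>\<^bsub>C\<^esub> \<phi> X Y f \<cdot>\<^bsub>C\<^esub> u"
begin

section \<open>Transposition along an adjunction\<close>

lemma transpose_in_Hom:
  assumes "X \<in> Obj C" "f \<in> Hom D (ob L X) Y"
  shows "\<phi> X Y f \<in> Hom C X (ob R Y)"
  using bij_betwE[OF bij] assms L.D.Hom_Obj by blast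

lemma transpose_inj:
  assumes "X \<in> Obj C" "f \<in> Hom D (ob L X) Y" "g \<in> Hom D (ob L X) Y" "\<phi> X Y f = \<phi> X Y g"
  shows "f = g"
proof -
  have "inj_on (\<phi> X Y) (Hom D (ob L X) Y)"
    using bij assms(1) L.D.Hom_Obj[OF assms(2)] by (auto simp: bij_betw_def)
  then show ?thesis using assms by (auto dest: inj_onD)
qed

lemma transpose_surj:
  assumes "Y \<in> Obj D" "h \<in> Hom C X (ob R Y)"
  obtains f where "f \<in> Hom D (ob L X) Y" "\<phi> X Y f = h"
proof -
  have "\<phi> X Y ` Hom D (ob L X) Y = Hom C X (ob R Y)"
    using bij assms L.C.Hom_Obj[OF assms(2)] by (auto simp: bij_betw_def)
  then have "h \<in> \<phi> X Y ` Hom D (ob L X) Y" using assms(2) by simp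
  then show thesis using that by blast
qed

lemma transpose_Comp_left:
  assumes "X \<in> Obj C" "f \<in> Hom D (ob L X) Y" "v \<in> Hom D Y Y'"
  shows "\<phi> X Y' (v \<cdot>\<^bsub>D\<^esub> f) = ar R v \<cdot>\<^bsub>C\<^esub> \<phi> X Y f"
proof -
  have vf: "v \<cdot>\<^bsub>D\<^esub> f \<in> Hom D (ob L X) Y'" using L.D.Comp_in_Hom assms by blast
  have "ar R v \<cdot>\<^bsub>C\<^esub> \<phi> X Y f \<in> Hom C X (ob R Y')"
    using L.C.Comp_in_Hom[OF transpose_in_Hom R.ar_in_Hom] assms by blast
  then show ?thesis
    using natural[OF L.C.Id_in_Hom[OF assms(1)] assms(3,2)]
    by (simp add: L.ar_Id assms(1) L.D.Comp_Id[OF vf] L.C.Comp_Id)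
qed

lemma transpose_Comp_right:
  assumes "u \<in> Hom C X' X" "f \<in> Hom D (ob L X) Y"
  shows "\<phi> X' Y (f \<cdot>\<^bsub>D\<^esub> ar L u) = \<phi> X Y f \<cdot>\<^bsub>C\<^esub> u"
proof -
  have X: "X \<in> Obj C" and Y: "Y \<in> Obj D" using L.C.Hom_Obj L.D.Hom_Obj assms by blast+
  show ?thesis
    using natural[OF assms(1) L.D.Id_in_Hom[OF Y] assms(2)] L.D.Id_Comp[OF assms(2)] Y
      L.C.Id_Comp[OF transpose_in_Hom[OF X assms(2)]] by (simp add: R.ar_Id)
qed

end

lemma is_left_adjointE:
  assumes "is_left_adjoint C D L R"
  obtains \<phi> where "adjunction C D L R \<phi>"
proof -
  obtain \<phi> where LR: "category_functor C D L" "category_functor D C R"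
    and \<phi>: "\<forall>X\<in>Obj C. \<forall>Y\<in>Obj D. bij_betw (\<phi> X Y) (Hom D (ob L X) Y) (Hom C X (ob R Y))"
      "\<forall>X\<in>Obj C. \<forall>X'\<in>Obj C. \<forall>Y\<in>Obj D. \<forall>Y'\<in>Obj D.
         \<forall>u\<in>Hom C X' X. \<forall>v\<in>Hom D Y Y'. \<forall>f\<in>Hom D (ob L X) Y.
           \<phi> X' Y' (v \<cdot>\<^bsub>D\<^esub> f \<cdot>\<^bsub>D\<^esub> ar L u) = ar R v \<cdot>\<^bsub>C\<^esub> \<phi> X Y f \<cdot>\<^bsub>C\<^esub> u"
    using assms unfolding is_left_adjoint_def by blast
  interpret L: category_functor C D L by fact
  interpret R: category_functor D C R by fact
  have "adjunction C D L R \<phi>"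
    using \<phi> L.C.Hom_Obj L.D.Hom_Obj by unfold_locales blast+
  then show thesis using that by blast
qed

locale preadditive_adjunction = adjunction C D L R \<phi> +
  C: preadditive_category C + D: preadditive_category D
  for C :: "('o, 'm) cat" and D :: "('p, 'n) cat" and L R \<phi>
begin

text \<open>Naturality determines the value: the zero arrow out of \<open>ob L X\<close> absorbs
  \<open>ar L (Zero C X X)\<close>, and this becomes precomposition of the transpose with a zero
  arrow.\<close>

lemma transpose_Zero:
  assumes X: "X \<in> Obj C" and Y: "Y \<in> Obj D"
  shows "\<phi> X Y (Zero D (ob L X) Y) = Zero C X (ob R Y)"
proof -
  let ?z = "Zero D (ob L X) Y"
  have z: "?z \<in> Hom D (ob L X) Y" using D.Zero_in_Hom L.ob_in_Obj X Y by blast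
  have x: "Zero C X X \<in> Hom C X X" using C.Zero_in_Hom X by blast
  have "\<phi> X Y ?z = \<phi> X Y (?z \<cdot>\<^bsub>D\<^esub> ar L (Zero C X X))"
    using D.Zero_Comp[OF Y L.ar_in_Hom[OF x]] by simp
  also have "\<dots> = \<phi> X Y ?z \<cdot>\<^bsub>C\<^esub> Zero C X X" using transpose_Comp_right[OF x z] .
  also have "\<dots> = Zero C X (ob R Y)" using C.Comp_Zero[OF X transpose_in_Hom[OF X z]] .
  finally show ?thesis .
qed

end

text \<open>Transposition turns factoring \<open>h\<close> through \<open>ar L c\<close> into
  factoring its transpose through the cokernel \<open>c\<close>; the resulting arrow is transposed
  back.\<close>

lemma left_adjoint_right_exact:
  assumes "additive_functor C D L" "is_left_adjoint C D L R" "abelian_category C" "abelian_category D"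
  shows "right_exact_functor C D L"
proof -
  interpret C: abelian_category C by fact
  interpret D: abelian_category D by fact
  interpret L: additive_functor C D L by fact
  obtain \<phi> where "adjunction C D L R \<phi>" using assms(2) is_left_adjointE by blast
  then interpret adjunction C D L R \<phi> .
  interpret preadditive_adjunction C D L R \<phi> by unfold_locales
  show ?thesis
  proof unfold_locales
    fix c f
    assume c: "is_cokernel C c f"
    let ?X = "Dom C f" and ?Y = "Cod C f" and ?Q = "Cod C c"
    have f: "f \<in> Hom C ?X ?Y" using c by (auto simp: is_cokernel_def Hom_def)
    note ch = C.is_cokernel_Hom[OF c f]
    note Obj = C.Hom_Obj[OF f] C.Hom_Obj[OF ch(1)]
    have Lf: "ar L f \<in> Hom D (ob L ?X) (ob L ?Y)" and Lc: "ar L c \<in> Hom D (ob L ?Y) (ob L ?Q)"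
      using L.ar_in_Hom f ch by blast+
    have 0: "ar L c \<cdot>\<^bsub>D\<^esub> ar L f = Zero D (ob L ?X) (ob L ?Q)"
      using L.ar_Comp[OF f ch(1)] ch(2) L.ar_Zero Obj by simp
    have "\<exists>!u. u \<in> Hom D (ob L ?Q) W \<and> u \<cdot>\<^bsub>D\<^esub> ar L c = h"
      if h: "h \<in> Hom D (ob L ?Y) W" "h \<cdot>\<^bsub>D\<^esub> ar L f = Zero D (ob L ?X) W" for W h
    proof -
      have W: "W \<in> Obj D" using D.Hom_Obj h by blast
      have "\<phi> ?Y W h \<cdot>\<^bsub>C\<^esub> f = Zero C ?X (ob R W)"
        using transpose_Comp_right[OF f h(1)] h(2) transpose_Zero[OF Obj(1) W] by simp
      then obtain u where u: "u \<in> Hom C ?Q (ob R W)" "u \<cdot>\<^bsub>C\<^esub> c = \<phi> ?Y W h"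
        using C.is_cokernel_factor[OF c f transpose_in_Hom[OF Obj(2) h(1)]] by blast
      obtain v where v: "v \<in> Hom D (ob L ?Q) W" "\<phi> ?Q W v = u" using transpose_surj[OF W u(1)] .
      have "\<phi> ?Y W (v \<cdot>\<^bsub>D\<^esub> ar L c) = \<phi> ?Y W h"
        using transpose_Comp_right[OF ch(1) v(1)] v(2) u(2) by simp
      then have "v \<cdot>\<^bsub>D\<^esub> ar L c = h"
        using transpose_inj[OF Obj(2)] D.Comp_in_Hom[OF Lc v(1)] h(1) by blast
      moreover have "w = v" if w: "w \<in> Hom D (ob L ?Q) W" "w \<cdot>\<^bsub>D\<^esub> ar L c = h" for w
      proof -
        have "\<phi> ?Q W w \<cdot>\<^bsub>C\<^esub> c = u \<cdot>\<^bsub>C\<^esub> c"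
          using transpose_Comp_right[OF ch(1) w(1)] w(2) u(2) by simp
        then have "\<phi> ?Q W w = u"
          using C.epi_cancel[OF C.is_cokernel_epi[OF c] ch(1)] transpose_in_Hom[OF Obj(4) w(1)] u(1)
          by blast
        then show ?thesis using transpose_inj[OF Obj(4) w(1) v(1)] v(2) by simp
      qed
      ultimately show ?thesis using v(1) by blast
    qed
    moreover have "ar L f \<in> Arr D" "Dom D (ar L f) = ob L ?X" "Cod D (ar L f) = ob L ?Y"
      "ar L c \<in> Arr D" "Dom D (ar L c) = ob L ?Y" "Cod D (ar L c) = ob L ?Q"
      using Lf Lc by (auto simp: Hom_def)
    ultimately show "is_cokernel D (ar L c) (ar L f)" using 0 unfolding is_cokernel_def by auto
  qed
qed

section \<open>Full subcategories\<close>

lemma Hom_full_subcategory: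
  "Hom (full_subcategory C S) X Y = (if X \<in> S \<and> Y \<in> S then Hom C X Y else {})"
  by (auto simp: Hom_def full_subcategory_def)

lemma full_subcategory_simps [simp]:
  "Obj (full_subcategory C S) = Obj C \<inter> S"
  "Arr (full_subcategory C S) = {f \<in> Arr C. Dom C f \<in> S \<and> Cod C f \<in> S}"
  "Comp (full_subcategory C S) = Comp C" "Id (full_subcategory C S) = Id C"
  "Plus (full_subcategory C S) = Plus C" "Zero (full_subcategory C S) = Zero C"
  "Dom (full_subcategory C S) = Dom C" "Cod (full_subcategory C S) = Cod C"
  by (simp_all add: full_subcategory_def)

lemma (in preadditive_category) preadditive_full_subcategory:
  "preadditive_category (full_subcategory C S)"
proof (intro preadditive_category.intro preadditive_category_axioms.intro)
  show "category (full_subcategory C S)"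
    by unfold_locales (auto simp: Hom_full_subcategory Id_in_Hom Comp_in_Hom Comp_assoc Comp_Id
        Id_Comp Dom_in_Obj Cod_in_Obj split: if_splits)
  show "comm_group (Hom_group (full_subcategory C S) X Y)"
    if "X \<in> Obj (full_subcategory C S)" "Y \<in> Obj (full_subcategory C S)" for X Y
    using that Hom_comm_group by (simp add: Hom_group_def Hom_full_subcategory)
qed (auto simp: Hom_full_subcategory Comp_Plus_right Comp_Plus_left split: if_splits)

lemma (in additive_functor) additive_full_subcategory:
  assumes "\<And>X. X \<in> Obj C \<Longrightarrow> X \<in> S \<Longrightarrow> ob F X \<in> T"
  shows "additive_functor (full_subcategory C S) (full_subcategory D T) F"
proof -
  interpret S: preadditive_category "full_subcategory C S" by (rule C.preadditive_full_subcategory)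
  interpret T: preadditive_category "full_subcategory D T" by (rule D.preadditive_full_subcategory)
  show ?thesis
  proof unfold_locales
    fix X Y f
    assume "f \<in> Hom (full_subcategory C S) X Y"
    then show "ar F f \<in> Hom (full_subcategory D T) (ob F X) (ob F Y)"
      using ar_in_Hom assms C.Hom_Obj by (auto simp: Hom_full_subcategory split: if_splits)
  next
    fix X Y
    assume "X \<in> Obj (full_subcategory C S)" "Y \<in> Obj (full_subcategory C S)"
    then show "ar F \<in> hom (Hom_group (full_subcategory C S) X Y)
        (Hom_group (full_subcategory D T) (ob F X) (ob F Y))"
      using ar_hom assms by (simp add: Hom_group_def Hom_full_subcategory)
  qed (use assms ob_in_Obj ar_Id ar_Comp in \<open>auto simp: Hom_full_subcategory split: if_splits\<close>)
qed

section \<open>Right wide Morita contexts\<close>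

text \<open>For the transposed context this is the annihilated class, see
  \<open>annihilated_eq_vanishing\<close>, now as a condition on a single component.
  \<open>T\<close> only names the domain of that component.\<close>

definition vanishing :: "('o, 'm) cat \<Rightarrow> ('o, 'm, 'o, 'm) func \<Rightarrow> ('o \<Rightarrow> 'm) \<Rightarrow> 'o set" where
  "vanishing C T \<epsilon> = {X \<in> Obj C. \<epsilon> X = Zero C (ob T X) X}"

text \<open>Has the shape of \<open>proj_objects\<close> with the class as a parameter, so that it
  can be formed for \<open>vanishing\<close>.\<close>

definition relative_proj :: "('o, 'm) cat \<Rightarrow> 'o set \<Rightarrow> 'o set" where
  "relative_proj C S = {M \<in> Obj C. is_cotorsion_free C S M \<and> is_projective_rel C S M}"

text \<open>The dual notion, with exactness and both transformations reversed. The equivalence is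
  proved at this level; the adjunctions enter only when such a context is constructed.\<close>

locale right_wide_Morita_context =
  L: right_exact_functor A B L + R: right_exact_functor B A R
  for A :: "('a, 'm) cat" and B :: "('b, 'n) cat"
    and L :: "('a, 'm, 'b, 'n) func" and R :: "('b, 'n, 'a, 'm) func" +
  fixes \<epsilon> :: "'a \<Rightarrow> 'm" and \<delta> :: "'b \<Rightarrow> 'n"
  assumes natural_eps: "natural_transformation A A (comp_func R L) id_func \<epsilon>"
    and natural_del: "natural_transformation B B (comp_func L R) id_func \<delta>"
    and L_eps: "X \<in> Obj A \<Longrightarrow> ar L (\<epsilon> X) = \<delta> (ob L X)"
    and R_del: "Y \<in> Obj B \<Longrightarrow> ar R (\<delta> Y) = \<epsilon> (ob R Y)"
begin

text \<open>The axioms are symmetric, so every fact about \<open>A\<close> yields its mirror image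
  about \<open>B\<close>.\<close>

lemma swap: "right_wide_Morita_context B A R L \<delta> \<epsilon>"
  using natural_eps natural_del L_eps R_del by unfold_locales

lemma eps_in_Hom:
  assumes "X \<in> Obj A"
  shows "\<epsilon> X \<in> Hom A (ob R (ob L X)) X"
  using natural_eps assms by (simp add: natural_transformation_def comp_func_def id_func_def)

lemma eps_natural:
  assumes "f \<in> Hom A X Y"
  shows "\<epsilon> Y \<cdot>\<^bsub>A\<^esub> ar R (ar L f) = f \<cdot>\<^bsub>A\<^esub> \<epsilon> X"
  using natural_eps assms L.C.Hom_Obj[OF assms]
  by (simp add: natural_transformation_def comp_func_def id_func_def)

lemma del_in_Hom:
  assumes "Y \<in> Obj B"
  shows "\<delta> Y \<in> Hom B (ob L (ob R Y)) Y"
  using natural_del assms by (simp add: natural_transformation_def comp_func_def id_func_def)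

lemma del_natural:
  assumes "f \<in> Hom B X Y"
  shows "\<delta> Y \<cdot>\<^bsub>B\<^esub> ar L (ar R f) = f \<cdot>\<^bsub>B\<^esub> \<delta> X"
  using natural_del assms L.D.Hom_Obj[OF assms]
  by (simp add: natural_transformation_def comp_func_def id_func_def)

text \<open>Naturality gives \<open>\<epsilon> Y \<cdot> R L e = e \<cdot> \<epsilon> X = 0\<close>,
  and \<open>R L e\<close> is an epimorphism by right exactness. Hypothesis \<open>0\<close> covers
  both quotients of objects in the class and the cokernel of \<open>\<epsilon> X\<close>.\<close>

lemma vanishing_epi:
  assumes X: "X \<in> Obj A" and e: "is_epi A e" "e \<in> Hom A X Y"
    and 0: "e \<cdot>\<^bsub>A\<^esub> \<epsilon> X = Zero A (ob R (ob L X)) Y"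
  shows "Y \<in> vanishing A (comp_func R L) \<epsilon>"
proof -
  have Y: "Y \<in> Obj A" using e L.C.Hom_Obj by blast
  have RLe: "ar R (ar L e) \<in> Hom A (ob R (ob L X)) (ob R (ob L Y))"
    using L.ar_in_Hom R.ar_in_Hom e by blast
  have "is_epi A (ar R (ar L e))" using L.preserves_epi R.preserves_epi e by blast
  then have "\<epsilon> Y = Zero A (ob R (ob L Y)) Y"
    using L.C.epi_kill[OF _ RLe eps_in_Hom[OF Y]] eps_natural[OF e(2)] 0 by simp
  then show ?thesis using Y by (simp add: vanishing_def comp_func_def)
qed

lemma vanishing_R:
  assumes "Y \<in> vanishing B (comp_func L R) \<delta>"
  shows "ob R Y \<in> vanishing A (comp_func R L) \<epsilon>"
proof -
  have "Y \<in> Obj B" "\<delta> Y = Zero B (ob L (ob R Y)) Y"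
    using assms by (simp_all add: vanishing_def comp_func_def)
  then have "\<epsilon> (ob R Y) = Zero A (ob R (ob L (ob R Y))) (ob R Y)"
    using R_del R.ar_Zero L.ob_in_Obj R.ob_in_Obj by metis
  then show ?thesis using \<open>Y \<in> Obj B\<close> R.ob_in_Obj by (simp add: vanishing_def comp_func_def)
qed

text \<open>As \<open>k\<close> is a monomorphism, it suffices that
  \<open>k \<cdot> \<epsilon> ?K\<close> vanishes. By naturality this is
  \<open>\<epsilon> (R L X) \<cdot> R L k\<close>, which equals
  \<open>R L (\<epsilon> X \<cdot> k)\<close>.\<close>

lemma kernel_eps_vanishing:
  assumes X: "X \<in> Obj A" and k: "is_kernel A k (\<epsilon> X)"
  shows "Dom A k \<in> vanishing A (comp_func R L) \<epsilon>"
proof -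
  let ?Y = "ob R (ob L X)" and ?K = "Dom A k"
  let ?T = "ob R (ob L ?K)"
  note e = eps_in_Hom[OF X]
  note kh = L.C.is_kernel_Hom[OF k e]
  have K: "?K \<in> Obj A" using L.C.Hom_Obj kh by blast
  have T: "?T \<in> Obj A" using L.ob_in_Obj R.ob_in_Obj K by blast
  have "k \<cdot>\<^bsub>A\<^esub> \<epsilon> ?K = \<epsilon> ?Y \<cdot>\<^bsub>A\<^esub> ar R (ar L k)" using eps_natural[OF kh(1)] by simp
  \<comment> \<open>The two compatibilities combine to
    \<open>R L (\<epsilon> X) = R (\<delta> (L X)) = \<epsilon> (R L X)\<close>.\<close>
  also have "\<epsilon> ?Y = ar R (ar L (\<epsilon> X))" using L_eps R_del X L.ob_in_Obj by metis
  also have "ar R (ar L (\<epsilon> X)) \<cdot>\<^bsub>A\<^esub> ar R (ar L k) = ar R (ar L (\<epsilon> X \<cdot>\<^bsub>A\<^esub> k))"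
    using L.ar_Comp[OF kh(1) e] R.ar_Comp[OF L.ar_in_Hom[OF kh(1)] L.ar_in_Hom[OF e]] by simp
  also have "\<dots> = Zero A ?T ?Y"
    using kh(2) L.ar_Zero R.ar_Zero K X L.ob_in_Obj by simp
  also have "\<dots> = k \<cdot>\<^bsub>A\<^esub> Zero A ?T ?K" using L.C.Comp_Zero[OF T kh(1)] by simp
  finally have "\<epsilon> ?K = Zero A ?T ?K"
    using L.C.mono_cancel[OF L.C.is_kernel_mono[OF k] kh(1) eps_in_Hom[OF K]]
      L.C.Zero_in_Hom[OF T K] by blast
  then show ?thesis using K by (simp add: vanishing_def comp_func_def)
qed

text \<open>The cokernel object of \<open>\<epsilon> X\<close> lies in the class, so the cokernel
  \<open>c\<close> is zero; every arrow killing \<open>\<epsilon> X\<close> factors through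
  \<open>c\<close>.\<close>

lemma cotorsion_free_eps_epi:
  assumes "is_cotorsion_free A (vanishing A (comp_func R L) \<epsilon>) X"
  shows "is_epi A (\<epsilon> X)"
proof -
  have X: "X \<in> Obj A" using assms by (simp add: is_cotorsion_free_def)
  note e = eps_in_Hom[OF X]
  obtain c where c: "is_cokernel A c (\<epsilon> X)" using L.C.ex_cokernel e by (auto simp: Hom_def)
  note ch = L.C.is_cokernel_Hom[OF c e]
  let ?Q = "Cod A c"
  have "is_epi A c" using L.C.is_cokernel_epi c by blast
  then have c0: "c = Zero A X ?Q"
    using vanishing_epi[OF X _ ch] assms ch(1) unfolding is_cotorsion_free_def by blast
  show ?thesis
  proof (rule L.C.is_epiI[OF e])
    fix W g
    assume g: "g \<in> Hom A X W" and "g \<cdot>\<^bsub>A\<^esub> \<epsilon> X = Zero A (ob R (ob L X)) W"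
    then obtain u where u: "u \<in> Hom A ?Q W" "u \<cdot>\<^bsub>A\<^esub> c = g" using L.C.is_cokernel_factor[OF c e] by blast
    then show "g = Zero A X W" using L.C.Comp_Zero[OF X u(1)] c0 by simp
  qed
qed

lemma eps_iso:
  assumes "X \<in> relative_proj A (vanishing A (comp_func R L) \<epsilon>)"
  obtains s where "s \<in> Hom A X (ob R (ob L X))" "\<epsilon> X \<cdot>\<^bsub>A\<^esub> s = Id A X"
    "s \<cdot>\<^bsub>A\<^esub> \<epsilon> X = Id A (ob R (ob L X))"
proof -
  let ?V = "vanishing A (comp_func R L) \<epsilon>" and ?Y = "ob R (ob L X)"
  have X: "X \<in> Obj A" and cot: "is_cotorsion_free A ?V X" and proj: "is_projective_rel A ?V X"
    using assms by (simp_all add: relative_proj_def)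
  note e = eps_in_Hom[OF X]
  have Y: "?Y \<in> Obj A" using L.C.Hom_Obj e by blast
  note epi = cotorsion_free_eps_epi[OF cot]
  obtain k where k: "is_kernel A k (\<epsilon> X)" using L.C.ex_kernel e by (auto simp: Hom_def)
  let ?K = "Dom A k"
  note kh = L.C.is_kernel_Hom[OF k e]
  have KV: "?K \<in> ?V" using kernel_eps_vanishing[OF X k] .
  have K: "?K \<in> Obj A" using L.C.Hom_Obj kh by blast
  \<comment> \<open>A lift of the identity along \<open>\<epsilon> X\<close>, which is an
    epimorphism with kernel in the class.\<close>
  obtain s where s: "s \<in> Hom A X ?Y" "\<epsilon> X \<cdot>\<^bsub>A\<^esub> s = Id A X"
    using proj X Y e epi k KV L.C.Id_in_Hom[OF X] unfolding is_projective_rel_def by blast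
  have IY: "Id A ?Y \<in> Hom A ?Y ?Y" using L.C.Id_in_Hom Y by blast
  have se: "s \<cdot>\<^bsub>A\<^esub> \<epsilon> X \<in> Hom A ?Y ?Y" using L.C.Comp_in_Hom e s by blast
  \<comment> \<open>The complementary projection \<open>1 - s \<cdot> \<epsilon> X\<close>; its
    vanishing makes \<open>s\<close> a two-sided inverse.\<close>
  obtain d where d: "d \<in> Hom A ?Y ?Y" "Plus A d (s \<cdot>\<^bsub>A\<^esub> \<epsilon> X) = Id A ?Y"
    using L.C.ex_diff[OF IY se] .
  have "\<epsilon> X \<cdot>\<^bsub>A\<^esub> (s \<cdot>\<^bsub>A\<^esub> \<epsilon> X) = \<epsilon> X"
    using L.C.Comp_assoc[OF e s(1) e] s(2) L.C.Id_Comp[OF e] by simp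
  then have "Plus A (\<epsilon> X \<cdot>\<^bsub>A\<^esub> d) (\<epsilon> X) = \<epsilon> X"
    using L.C.Comp_Plus_right[OF d(1) se e] d(2) L.C.Comp_Id[OF e] by simp
  then have "\<epsilon> X \<cdot>\<^bsub>A\<^esub> d = Zero A ?Y X" using L.C.Plus_eq_self L.C.Comp_in_Hom d(1) e by blast
  then obtain r where r: "r \<in> Hom A ?Y ?K" "k \<cdot>\<^bsub>A\<^esub> r = d" using L.C.is_kernel_factor[OF k e d(1)] by blast
  have eY: "\<epsilon> ?Y = ar R (ar L (\<epsilon> X))" using L_eps R_del X L.ob_in_Obj by metis
  \<comment> \<open>Since \<open>\<epsilon> ?K = 0\<close>, naturality makes \<open>r\<close> kill
    \<open>\<epsilon> ?Y\<close>, which is an epimorphism because it is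
    \<open>R L (\<epsilon> X)\<close>.\<close>
  have "r \<cdot>\<^bsub>A\<^esub> \<epsilon> ?Y = \<epsilon> ?K \<cdot>\<^bsub>A\<^esub> ar R (ar L r)" using eps_natural[OF r(1)] by simp
  also have "\<dots> = Zero A (ob R (ob L ?Y)) ?K"
    using KV L.C.Zero_Comp[OF K R.ar_in_Hom[OF L.ar_in_Hom[OF r(1)]]]
    by (simp add: vanishing_def comp_func_def)
  finally have "r = Zero A ?Y ?K"
    using L.C.epi_kill[OF _ eps_in_Hom[OF Y] r(1)] epi L.preserves_epi R.preserves_epi eY by simp
  then have "d = Zero A ?Y ?Y" using L.C.Comp_Zero[OF Y kh(1)] r(2) by simp
  then have "s \<cdot>\<^bsub>A\<^esub> \<epsilon> X = Id A ?Y" using d(2) L.C.Plus_Zero(2)[OF se] by simp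
  then show thesis using that s by blast
qed

text \<open>A kernel of \<open>R p\<close> is the image of \<open>R l\<close>, hence a quotient of an object at which \<open>\<epsilon>\<close> vanishes.\<close>

lemma kernel_R_vanishing:
  assumes p: "is_epi B p" "p \<in> Hom B Y Y'" and l: "is_kernel B l p"
    and lV: "Dom B l \<in> vanishing B (comp_func L R) \<delta>" and k: "is_kernel A k (ar R p)"
  shows "Dom A k \<in> vanishing A (comp_func R L) \<epsilon>"
proof -
  let ?RL = "ob R (Dom B l)"
  note lh = L.D.is_kernel_Hom[OF l p(2)]
  have Rp: "ar R p \<in> Hom A (ob R Y) (ob R Y')" and Rl: "ar R l \<in> Hom A ?RL (ob R Y)"
    using R.ar_in_Hom p(2) lh(1) by blast+
  have c: "is_cokernel A (ar R p) (ar R l)"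
    using R.preserves_cokernel L.D.epi_is_cokernel_of_kernel[OF p l] by blast
  have "ar R p \<cdot>\<^bsub>A\<^esub> ar R l = Zero A ?RL (ob R Y')"
    using L.C.is_cokernel_Hom(2)[OF c Rl] Rp by (simp add: Hom_def)
  then obtain e where e: "e \<in> Hom A ?RL (Dom A k)" "k \<cdot>\<^bsub>A\<^esub> e = ar R l"
    using L.C.is_kernel_factor[OF k Rp Rl] by blast
  have epi: "is_epi A e" using L.C.epi_onto_image[OF Rl c k e] .
  have RL: "?RL \<in> Obj A" "ob R (ob L ?RL) \<in> Obj A"
    using L.C.Hom_Obj[OF e(1)] L.ob_in_Obj R.ob_in_Obj by blast+
  have "\<epsilon> ?RL = Zero A (ob R (ob L ?RL)) ?RL"
    using vanishing_R[OF lV] by (simp add: vanishing_def comp_func_def)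
  then show ?thesis using vanishing_epi[OF RL(1) epi e(1)] L.C.Comp_Zero[OF RL(2) e(1)] by simp
qed

text \<open>Applying \<open>L\<close> to the inverse \<open>s\<close> of \<open>\<epsilon> X\<close>
  gives a section of \<open>\<delta> (L X)\<close>, since \<open>L \<epsilon> = \<delta> L\<close>.
  Hence every arrow out of \<open>L X\<close> factors through \<open>\<delta>\<close> at its target,
  which carries both properties across.\<close>

lemma L_relative_proj:
  assumes "X \<in> relative_proj A (vanishing A (comp_func R L) \<epsilon>)"
  shows "ob L X \<in> relative_proj B (vanishing B (comp_func L R) \<delta>)"
proof -
  let ?Z = "ob L X" and ?V = "vanishing B (comp_func L R) \<delta>"
  have X: "X \<in> Obj A" using assms by (simp add: relative_proj_def)
  have Z: "?Z \<in> Obj B" "ob R ?Z \<in> Obj A" using L.ob_in_Obj R.ob_in_Obj X by blast+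
  note e = eps_in_Hom[OF X]
  obtain s where s: "s \<in> Hom A X (ob R ?Z)" "\<epsilon> X \<cdot>\<^bsub>A\<^esub> s = Id A X" using eps_iso[OF assms] .
  note dZ = del_in_Hom[OF Z(1)]
  note Ls = L.ar_in_Hom[OF s(1)]
  have ds: "\<delta> ?Z \<cdot>\<^bsub>B\<^esub> ar L s = Id B ?Z"
    using L.ar_Comp[OF s(1) e] s(2) L_eps[OF X] L.ar_Id[OF X] by simp
  have through_R: "f = \<delta> W \<cdot>\<^bsub>B\<^esub> (ar L (ar R f) \<cdot>\<^bsub>B\<^esub> ar L s)" if f: "f \<in> Hom B ?Z W" for f W
  proof -
    have W: "W \<in> Obj B" using L.D.Hom_Obj f by blast
    have "f = (f \<cdot>\<^bsub>B\<^esub> \<delta> ?Z) \<cdot>\<^bsub>B\<^esub> ar L s"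
      using L.D.Comp_assoc[OF Ls dZ f] ds L.D.Comp_Id[OF f] by simp
    also have "\<dots> = (\<delta> W \<cdot>\<^bsub>B\<^esub> ar L (ar R f)) \<cdot>\<^bsub>B\<^esub> ar L s" using del_natural[OF f] by simp
    also have "\<dots> = \<delta> W \<cdot>\<^bsub>B\<^esub> (ar L (ar R f) \<cdot>\<^bsub>B\<^esub> ar L s)"
      using L.D.Comp_assoc[OF Ls L.ar_in_Hom[OF R.ar_in_Hom[OF f]] del_in_Hom[OF W]] .
    finally show ?thesis .
  qed
  \<comment> \<open>Every such arrow, epimorphism or not, factors through
    \<open>\<delta> W = 0\<close>.\<close>
  have "f = Zero B ?Z W" if W: "W \<in> ?V" and f: "f \<in> Hom B ?Z W" for W f
  proof -
    have "W \<in> Obj B" "\<delta> W = Zero B (ob L (ob R W)) W"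
      using W by (simp_all add: vanishing_def comp_func_def)
    moreover have "ar L (ar R f) \<cdot>\<^bsub>B\<^esub> ar L s \<in> Hom B ?Z (ob L (ob R W))"
      using L.D.Comp_in_Hom[OF Ls L.ar_in_Hom[OF R.ar_in_Hom[OF f]]] .
    ultimately show ?thesis using through_R[OF f] L.D.Zero_Comp by simp
  qed
  then have cot: "is_cotorsion_free B ?V ?Z" using Z by (simp add: is_cotorsion_free_def)
  have "\<exists>g\<in>Hom B ?Z Y. p \<cdot>\<^bsub>B\<^esub> g = f"
    if p: "is_epi B p" "p \<in> Hom B Y Y'" and l: "is_kernel B l p" "Dom B l \<in> ?V"
      and f: "f \<in> Hom B ?Z Y'" for Y Y' p l f
  proof -
    have Y: "Y \<in> Obj B" "Y' \<in> Obj B" using L.D.Hom_Obj p by blast+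
    note Rp = R.ar_in_Hom[OF p(2)] and Rf = R.ar_in_Hom[OF f]
    obtain k where k: "is_kernel A k (ar R p)" using L.C.ex_kernel Rp by (auto simp: Hom_def)
    have "Dom A k \<in> vanishing A (comp_func R L) \<epsilon>" using kernel_R_vanishing[OF p l k] .
    moreover have "is_epi A (ar R p)" using R.preserves_epi p by blast
    moreover have "ar R f \<cdot>\<^bsub>A\<^esub> s \<in> Hom A X (ob R Y')" using L.C.Comp_in_Hom s(1) Rf by blast
    moreover have "is_projective_rel A (vanishing A (comp_func R L) \<epsilon>) X"
      using assms by (simp add: relative_proj_def)
    \<comment> \<open>Lifting \<open>f\<close> along \<open>p\<close> is replaced by lifting
      \<open>ar R f \<cdot> s\<close> along \<open>ar R p\<close>, a problem for \<open>X\<close> in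
      \<open>A\<close>.\<close>
    ultimately obtain h where h: "h \<in> Hom A X (ob R Y)" "ar R p \<cdot>\<^bsub>A\<^esub> h = ar R f \<cdot>\<^bsub>A\<^esub> s"
      using k Rp L.C.Hom_Obj[OF Rp] unfolding is_projective_rel_def by blast
    note dY = del_in_Hom[OF Y(1)] and dY' = del_in_Hom[OF Y(2)]
    note Lh = L.ar_in_Hom[OF h(1)]
    note LRp = L.ar_in_Hom[OF Rp]
    \<comment> \<open>The lift \<open>h\<close> is carried back by \<open>L\<close> and
      \<open>\<delta>\<close>; naturality of \<open>\<delta>\<close> at \<open>p\<close> and
      \<open>through_R\<close> for \<open>f\<close> show that it lifts \<open>f\<close>.\<close>
    have g: "\<delta> Y \<cdot>\<^bsub>B\<^esub> ar L h \<in> Hom B ?Z Y" using L.D.Comp_in_Hom Lh dY by blast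
    have "p \<cdot>\<^bsub>B\<^esub> (\<delta> Y \<cdot>\<^bsub>B\<^esub> ar L h) = (\<delta> Y' \<cdot>\<^bsub>B\<^esub> ar L (ar R p)) \<cdot>\<^bsub>B\<^esub> ar L h"
      using L.D.Comp_assoc[OF Lh dY p(2)] del_natural[OF p(2)] by simp
    also have "\<dots> = \<delta> Y' \<cdot>\<^bsub>B\<^esub> ar L (ar R p \<cdot>\<^bsub>A\<^esub> h)"
      using L.D.Comp_assoc[OF Lh LRp dY'] L.ar_Comp[OF h(1) Rp] by simp
    also have "\<dots> = f" using h(2) L.ar_Comp[OF s(1) Rf] through_R[OF f] by simp
    finally show ?thesis using g by blast
  qed
  then have "is_projective_rel B ?V ?Z" using Z unfolding is_projective_rel_def by blast
  then show ?thesis using cot Z by (simp add: relative_proj_def)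
qed

text \<open>\<open>L_relative_proj\<close> for the context and for its swap puts
  \<open>R L X\<close> back in \<open>S\<close>, so the inverse from \<open>eps_iso\<close> is an
  arrow of the full subcategory.\<close>

lemma eps_natural_isomorphism:
  defines "S \<equiv> relative_proj A (vanishing A (comp_func R L) \<epsilon>)"
  shows "natural_isomorphism (full_subcategory A S) (full_subcategory A S) (comp_func R L) id_func \<epsilon>"
proof -
  interpret swap: right_wide_Morita_context B A R L \<delta> \<epsilon> by (rule swap)
  have RL: "ob R (ob L X) \<in> S" if "X \<in> S" for X
    using that L_relative_proj swap.L_relative_proj unfolding S_def by blast
  have "is_iso (full_subcategory A S) (\<epsilon> X)" if X: "X \<in> Obj A" "X \<in> S" for X
  proof -
    obtain s where "s \<in> Hom A X (ob R (ob L X))" "\<epsilon> X \<cdot>\<^bsub>A\<^esub> s = Id A X"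
      "s \<cdot>\<^bsub>A\<^esub> \<epsilon> X = Id A (ob R (ob L X))"
      using eps_iso X(2) unfolding S_def by blast
    then show ?thesis
      using eps_in_Hom[OF X(1)] X RL[OF X(2)]
      unfolding is_iso_def by (auto simp: Hom_def)
  qed
  then show ?thesis
    using eps_in_Hom eps_natural RL
    by (auto simp: natural_isomorphism_def natural_transformation_def Hom_full_subcategory
        comp_func_def id_func_def split: if_splits)
qed

theorem equivalent_relative_proj:
  "equivalent_via (full_subcategory A (relative_proj A (vanishing A (comp_func R L) \<epsilon>)))
    (full_subcategory B (relative_proj B (vanishing B (comp_func L R) \<delta>))) L R"
proof -
  interpret swap: right_wide_Morita_context B A R L \<delta> \<epsilon> by (rule swap)
  show ?thesis
    unfolding equivalent_via_def
    using L.additive_full_subcategory R.additive_full_subcategory L_relative_proj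
      swap.L_relative_proj eps_natural_isomorphism swap.eps_natural_isomorphism by blast
qed

end

section \<open>Transposing a left wide Morita context\<close>

text \<open>An arrow \<open>G' F' X \<rightarrow> X\<close> transposes under \<open>\<psi>\<close>
  to \<open>F' X \<rightarrow> G X\<close> and then under \<open>\<phi>\<close> to
  \<open>X \<rightarrow> F G X\<close>. The arrow \<open>\<epsilon> X\<close> is fixed by requiring
  this double transpose to be \<open>\<eta> X\<close>, and dually for
  \<open>\<delta>\<close>.\<close>

locale transposed_Morita_context =
  left_wide_Morita_context A B F G \<eta> \<rho> +
  P: preadditive_adjunction A B F' F \<phi> + Q: preadditive_adjunction B A G' G \<psi>
  for A :: "('a, 'm) cat" and B :: "('b, 'n) cat" and F G \<eta> \<rho> F' G' \<phi> \<psi> +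
  fixes \<epsilon> :: "'a \<Rightarrow> 'm" and \<delta> :: "'b \<Rightarrow> 'n"
  assumes eps_in_Hom: "X \<in> Obj A \<Longrightarrow> \<epsilon> X \<in> Hom A (ob G' (ob F' X)) X"
    and eps_transpose: "X \<in> Obj A \<Longrightarrow> \<phi> X (ob G X) (\<psi> (ob F' X) X (\<epsilon> X)) = \<eta> X"
    and del_in_Hom: "Y \<in> Obj B \<Longrightarrow> \<delta> Y \<in> Hom B (ob F' (ob G' Y)) Y"
    and del_transpose: "Y \<in> Obj B \<Longrightarrow> \<psi> Y (ob F Y) (\<phi> (ob G' Y) Y (\<delta> Y)) = \<rho> Y"
begin

lemma swap: "transposed_Morita_context B A G F \<rho> \<eta> G' F' \<psi> \<phi> \<delta> \<epsilon>"
  using natural_eta natural_rho G_eta F_rho eps_in_Hom eps_transpose del_in_Hom del_transpose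
  by unfold_locales

lemma eta_in_Hom:
  assumes "X \<in> Obj A"
  shows "\<eta> X \<in> Hom A X (ob F (ob G X))"
  using natural_eta assms by (simp add: natural_transformation_def comp_func_def id_func_def)

lemma eta_natural:
  assumes "f \<in> Hom A X Y"
  shows "\<eta> Y \<cdot>\<^bsub>A\<^esub> f = ar F (ar G f) \<cdot>\<^bsub>A\<^esub> \<eta> X"
  using natural_eta assms F.D.Hom_Obj[OF assms]
  by (simp add: natural_transformation_def comp_func_def id_func_def)

lemma rho_in_Hom:
  assumes "Y \<in> Obj B"
  shows "\<rho> Y \<in> Hom B Y (ob G (ob F Y))"
  using natural_rho assms by (simp add: natural_transformation_def comp_func_def id_func_def)

text \<open>Lets equations between arrows out of \<open>G' F' X\<close> be checked on double
  transposes, where they become equations about \<open>\<eta>\<close>.\<close>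

lemma transpose2_inj:
  assumes X: "X \<in> Obj A" and f: "f \<in> Hom A (ob G' (ob F' X)) Y" and g: "g \<in> Hom A (ob G' (ob F' X)) Y"
    and eq: "\<phi> X (ob G Y) (\<psi> (ob F' X) Y f) = \<phi> X (ob G Y) (\<psi> (ob F' X) Y g)"
  shows "f = g"
proof -
  have FX: "ob F' X \<in> Obj B" using P.L.ob_in_Obj X .
  show ?thesis
    using P.transpose_inj[OF X Q.transpose_in_Hom[OF FX f] Q.transpose_in_Hom[OF FX g] eq]
      Q.transpose_inj[OF FX f g] by blast
qed

text \<open>The double transposes of the two sides are the two sides of the naturality square of
  \<open>\<eta>\<close>.\<close>

lemma eps_natural:
  assumes f: "f \<in> Hom A X Y"
  shows "\<epsilon> Y \<cdot>\<^bsub>A\<^esub> ar G' (ar F' f) = f \<cdot>\<^bsub>A\<^esub> \<epsilon> X"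
proof -
  have Obj: "X \<in> Obj A" "Y \<in> Obj A" "ob F' X \<in> Obj B" "ob F' Y \<in> Obj B"
    using F.D.Hom_Obj[OF f] P.L.ob_in_Obj by blast+
  note eX = eps_in_Hom[OF Obj(1)] and eY = eps_in_Hom[OF Obj(2)]
  note pX = Q.transpose_in_Hom[OF Obj(3) eX] and pY = Q.transpose_in_Hom[OF Obj(4) eY]
  note F'f = P.L.ar_in_Hom[OF f]
  show ?thesis
  proof (rule transpose2_inj[OF Obj(1)])
    show "\<epsilon> Y \<cdot>\<^bsub>A\<^esub> ar G' (ar F' f) \<in> Hom A (ob G' (ob F' X)) Y"
      using F.D.Comp_in_Hom Q.L.ar_in_Hom F'f eY by blast
    show "f \<cdot>\<^bsub>A\<^esub> \<epsilon> X \<in> Hom A (ob G' (ob F' X)) Y" using F.D.Comp_in_Hom eX f by blast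
    have "\<phi> X (ob G Y) (\<psi> (ob F' X) Y (\<epsilon> Y \<cdot>\<^bsub>A\<^esub> ar G' (ar F' f))) = \<eta> Y \<cdot>\<^bsub>A\<^esub> f"
      using Q.transpose_Comp_right[OF F'f eY] P.transpose_Comp_right[OF f pY] eps_transpose[OF Obj(2)]
      by simp
    moreover have "\<phi> X (ob G Y) (\<psi> (ob F' X) Y (f \<cdot>\<^bsub>A\<^esub> \<epsilon> X)) = ar F (ar G f) \<cdot>\<^bsub>A\<^esub> \<eta> X"
      using Q.transpose_Comp_left[OF Obj(3) eX f] eps_transpose[OF Obj(1)]
        P.transpose_Comp_left[OF Obj(1) pX G.ar_in_Hom[OF f]]
      by simp
    ultimately show "\<phi> X (ob G Y) (\<psi> (ob F' X) Y (\<epsilon> Y \<cdot>\<^bsub>A\<^esub> ar G' (ar F' f)))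
      = \<phi> X (ob G Y) (\<psi> (ob F' X) Y (f \<cdot>\<^bsub>A\<^esub> \<epsilon> X))"
      using eta_natural[OF f] by simp
  qed
qed

text \<open>Both sides are compared after transposing under \<open>\<phi>\<close> and then
  \<open>\<psi>\<close>. The right side gives \<open>\<rho> (F' X)\<close>, the left side
  \<open>G u \<cdot> \<psi> (\<epsilon> X)\<close> with \<open>u\<close> the unit at
  \<open>X\<close>. These agree by \<open>F \<rho> = \<eta> F\<close> and naturality of
  \<open>\<eta>\<close> at \<open>u\<close>.\<close>

lemma F'_eps:
  assumes X: "X \<in> Obj A"
  shows "ar F' (\<epsilon> X) = \<delta> (ob F' X)"
proof -
  interpret swap: transposed_Morita_context B A G F \<rho> \<eta> G' F' \<psi> \<phi> \<delta> \<epsilon> by (rule swap)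
  let ?Z = "ob F' X"
  let ?u = "\<phi> X ?Z (Id B ?Z)"
  have Z: "?Z \<in> Obj B" using P.L.ob_in_Obj X .
  note I = F.C.Id_in_Hom[OF Z]
  note u = P.transpose_in_Hom[OF X I]
  note e = eps_in_Hom[OF X]
  note pe = Q.transpose_in_Hom[OF Z e]
  note Gu = G.ar_in_Hom[OF u]
  have unit: "\<phi> X W f = ar F f \<cdot>\<^bsub>A\<^esub> ?u" if f: "f \<in> Hom B ?Z W" for f W
    using P.transpose_Comp_left[OF X I f] F.C.Comp_Id[OF f] by simp
  \<comment> \<open>Transposing once more under \<open>\<phi>\<close> leaves
    \<open>\<eta> (F ?Z) \<cdot> ?u = F G ?u \<cdot> \<eta> X\<close>.\<close>
  have "\<rho> ?Z = ar G ?u \<cdot>\<^bsub>B\<^esub> \<psi> ?Z X (\<epsilon> X)"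
  proof (rule P.transpose_inj[OF X rho_in_Hom[OF Z]])
    show "ar G ?u \<cdot>\<^bsub>B\<^esub> \<psi> ?Z X (\<epsilon> X) \<in> Hom B ?Z (ob G (ob F ?Z))"
      using F.C.Comp_in_Hom pe Gu by blast
    have "\<phi> X (ob G (ob F ?Z)) (\<rho> ?Z) = \<eta> (ob F ?Z) \<cdot>\<^bsub>A\<^esub> ?u"
      using unit[OF rho_in_Hom[OF Z]] F_rho[OF Z] by simp
    also have "\<dots> = ar F (ar G ?u) \<cdot>\<^bsub>A\<^esub> \<eta> X" using eta_natural[OF u] .
    also have "\<dots> = \<phi> X (ob G (ob F ?Z)) (ar G ?u \<cdot>\<^bsub>B\<^esub> \<psi> ?Z X (\<epsilon> X))"
      using P.transpose_Comp_left[OF X pe Gu] eps_transpose[OF X] by simp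
    finally show "\<phi> X (ob G (ob F ?Z)) (\<rho> ?Z)
      = \<phi> X (ob G (ob F ?Z)) (ar G ?u \<cdot>\<^bsub>B\<^esub> \<psi> ?Z X (\<epsilon> X))" .
  qed
  moreover have "\<psi> ?Z (ob F ?Z) (\<phi> (ob G' ?Z) ?Z (ar F' (\<epsilon> X))) = ar G ?u \<cdot>\<^bsub>B\<^esub> \<psi> ?Z X (\<epsilon> X)"
    using P.transpose_Comp_right[OF e I] F.C.Id_Comp[OF P.L.ar_in_Hom[OF e]]
      Q.transpose_Comp_left[OF Z e u] by simp
  ultimately show ?thesis
    using swap.transpose2_inj[OF Z P.L.ar_in_Hom[OF e] del_in_Hom[OF Z]] del_transpose[OF Z] by simp
qed

text \<open>By naturality \<open>\<eta> M \<cdot> f = F G f \<cdot> \<eta> X\<close>, so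
  annihilation of \<open>X\<close> means \<open>\<eta> X = 0\<close>, the identity being the
  decisive test arrow. Double transposition preserves and reflects zero, so this means
  \<open>\<epsilon> X = 0\<close>.\<close>

lemma annihilated_eq_vanishing: "annihilated A \<eta> = vanishing A (comp_func G' F') \<epsilon>"
proof -
  have "(\<forall>M\<in>Obj A. \<forall>f\<in>Hom A X M. \<eta> M \<cdot>\<^bsub>A\<^esub> f = Zero A X (Cod A (\<eta> M)))
      \<longleftrightarrow> \<epsilon> X = Zero A (ob G' (ob F' X)) X" (is "?ann \<longleftrightarrow> ?van")
    if X: "X \<in> Obj A" for X
  proof -
    note eta = eta_in_Hom[OF X] and I = F.D.Id_in_Hom[OF X]
    have FGX: "ob F (ob G X) \<in> Obj A" and F'X: "ob F' X \<in> Obj B" and GX: "ob G X \<in> Obj B"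
      and G'F'X: "ob G' (ob F' X) \<in> Obj A"
      using F.ob_in_Obj G.ob_in_Obj P.L.ob_in_Obj Q.L.ob_in_Obj X by blast+
    have cod: "Cod A (\<eta> M) = ob F (ob G M)" if "M \<in> Obj A" for M
      using eta_in_Hom[OF that] by (simp add: Hom_def)
    have "?ann \<longleftrightarrow> \<eta> X = Zero A X (ob F (ob G X))"
    proof
      assume ?ann
      then have "\<eta> X \<cdot>\<^bsub>A\<^esub> Id A X = Zero A X (ob F (ob G X))" using X I cod by metis
      then show "\<eta> X = Zero A X (ob F (ob G X))" using F.D.Comp_Id[OF eta] by simp
    next
      assume 0: "\<eta> X = Zero A X (ob F (ob G X))"
      show ?ann
        using cod eta_natural F.D.Comp_Zero[OF X] F.ar_in_Hom G.ar_in_Hom 0 by metis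
    qed
    moreover have "\<phi> X (ob G X) (\<psi> (ob F' X) X (Zero A (ob G' (ob F' X)) X)) = Zero A X (ob F (ob G X))"
      using Q.transpose_Zero[OF F'X X] P.transpose_Zero[OF X GX] by simp
    ultimately show ?thesis
      using transpose2_inj[OF X eps_in_Hom[OF X] F.D.Zero_in_Hom[OF G'F'X X]] eps_transpose[OF X] by auto
  qed
  then show ?thesis by (auto simp: annihilated_def vanishing_def comp_func_def)
qed

lemma proj_objects_eq: "proj_objects A \<eta> = relative_proj A (vanishing A (comp_func G' F') \<epsilon>)"
  by (simp add: proj_objects_def relative_proj_def annihilated_eq_vanishing)

lemma right_wide_Morita_context:
  assumes "right_exact_functor A B F'" "right_exact_functor B A G'"
  shows "right_wide_Morita_context A B F' G' \<epsilon> \<delta>"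
proof -
  interpret swap: transposed_Morita_context B A G F \<rho> \<eta> G' F' \<psi> \<phi> \<delta> \<epsilon> by (rule swap)
  interpret F': right_exact_functor A B F' by fact
  interpret G': right_exact_functor B A G' by fact
  show ?thesis
    using eps_in_Hom del_in_Hom eps_natural swap.eps_natural F'_eps swap.F'_eps
    by unfold_locales (auto simp: natural_transformation_def comp_func_def id_func_def)
qed

end

section \<open>Construction of the transposed context and conclusion\<close>

theorem theorem4p6:
  fixes A :: "('a, 'm) cat" and B :: "('b, 'n) cat"
    and F :: "('b, 'n, 'a, 'm) func" and G :: "('a, 'm, 'b, 'n) func"
    and \<eta> :: "'a \<Rightarrow> 'm" and \<rho> :: "'b \<Rightarrow> 'n"
    and F' :: "('a, 'm, 'b, 'n) func" and G' :: "('b, 'n, 'a, 'm) func"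
  assumes "left_wide_Morita_context A B F G \<eta> \<rho>"
    and "additive_functor A B F'" and "is_left_adjoint A B F' F"
    and "additive_functor B A G'" and "is_left_adjoint B A G' G"
  shows "equivalent_via (full_subcategory A (proj_objects A \<eta>))
    (full_subcategory B (proj_objects B \<rho>)) F' G'"
proof -
  interpret left_wide_Morita_context A B F G \<eta> \<rho> by fact
  obtain \<phi> where "adjunction A B F' F \<phi>" using assms(3) is_left_adjointE by blast
  then interpret P: adjunction A B F' F \<phi> .
  obtain \<psi> where "adjunction B A G' G \<psi>" using assms(5) is_left_adjointE by blast
  then interpret Q: adjunction B A G' G \<psi> .
  have "\<exists>e. e \<in> Hom A (ob G' (ob F' X)) X \<and> \<phi> X (ob G X) (\<psi> (ob F' X) X e) = \<eta> X"
    if X: "X \<in> Obj A" for X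
  proof -
    have "\<eta> X \<in> Hom A X (ob F (ob G X))"
      using natural_eta X by (simp add: natural_transformation_def comp_func_def id_func_def)
    then show ?thesis using P.transpose_surj[OF G.ob_in_Obj[OF X]] Q.transpose_surj[OF X] by metis
  qed
  \<comment> \<open>The choice is made object by object; naturality follows afterwards from
    injectivity of the double transpose.\<close>
  then obtain \<epsilon> where \<epsilon>: "\<And>X. X \<in> Obj A \<Longrightarrow> \<epsilon> X \<in> Hom A (ob G' (ob F' X)) X"
    "\<And>X. X \<in> Obj A \<Longrightarrow> \<phi> X (ob G X) (\<psi> (ob F' X) X (\<epsilon> X)) = \<eta> X"
    by metis
  have "\<exists>d. d \<in> Hom B (ob F' (ob G' Y)) Y \<and> \<psi> Y (ob F Y) (\<phi> (ob G' Y) Y d) = \<rho> Y"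
    if Y: "Y \<in> Obj B" for Y
  proof -
    have "\<rho> Y \<in> Hom B Y (ob G (ob F Y))"
      using natural_rho Y by (simp add: natural_transformation_def comp_func_def id_func_def)
    then show ?thesis using Q.transpose_surj[OF F.ob_in_Obj[OF Y]] P.transpose_surj[OF Y] by metis
  qed
  then obtain \<delta> where \<delta>: "\<And>Y. Y \<in> Obj B \<Longrightarrow> \<delta> Y \<in> Hom B (ob F' (ob G' Y)) Y"
    "\<And>Y. Y \<in> Obj B \<Longrightarrow> \<psi> Y (ob F Y) (\<phi> (ob G' Y) Y (\<delta> Y)) = \<rho> Y"
    by metis
  interpret T: transposed_Morita_context A B F G \<eta> \<rho> F' G' \<phi> \<psi> \<epsilon> \<delta>
    using \<epsilon> \<delta> by unfold_locales
  interpret T': transposed_Morita_context B A G F \<rho> \<eta> G' F' \<psi> \<phi> \<delta> \<epsilon> by (rule T.swap)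
  have "right_exact_functor A B F'" "right_exact_functor B A G'"
    using left_adjoint_right_exact assms F.C.abelian_category_axioms F.D.abelian_category_axioms
    by blast+
  then interpret M: right_wide_Morita_context A B F' G' \<epsilon> \<delta> by (rule T.right_wide_Morita_context)
  show ?thesis using M.equivalent_relative_proj by (simp add: T.proj_objects_eq T'.proj_objects_eq)
qed

end
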